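(* Let $e^n=(e_1^n,\ldots,e_N^n)^T\in\mathbb{R}^N$, $n=1,\ldots,L$, be generated by $$\left(\frac{h\Delta t^{-\alpha}}{\Gamma(2-\alpha)}I+A+B\right)e^n=\frac{h\Delta t^{-\alpha}}{\Gamma(2-\alpha)}\left(\sum_{k=1}^{n-1}(a_{n-k-1}-a_{n-k})e^k+a_{n-1}e^0\right)+hr^n,\qquad n=1,2,\ldots,L,$$ with $e^0=(e_1^0,\ldots,e_N^0)^T\ge0$ and $r^n=(r_1^n,\ldots,r_N^n)^T\ge0$ for $n=1,\ldots,L$. Then $e^n\ge0$ for $n=1,\ldots,L$.
   Context: Vector inequalities are entrywise. Let $a<b$, $T>0$, $\alpha\in(0,1)$, $k_\alpha>0$ be real constants, and let $f:[a,b]\to\mathbb{R}$ be Lipschitz: $|f(x)-f(x')|\le C|x-x'|$ for all $x,x'\in[a,b]$. For positive integers $N,L$ put $h=(b-a)/(N+1)$, $x_i=a+ih$ ($i=0,\ldots,N+1$), $x_{i+\frac12}=a+(i+\frac12)h$ ($i=0,\ldots,N$), $\Delta t=T/L$. $\Gamma$ is the gamma function and $a_k=(k+1)^{1-\alpha}-k^{1-\alpha}$ for $k=0,1,2,\ldots$. Decompose $f=f^u+f^l+f^m$ with $f^u(x)=\max(f(x)-\frac{2k_\alpha}{h},0)$, $f^l(x)=\min(f(x)+\frac{2k_\alpha}{h},0)$, $f^m=f-f^u-f^l$. A subscript $i+\frac12$ denotes evaluation at $x_{i+\frac12}$, e.g. $f^m_{i+\frac12}=f^m(x_{i+\frac12})$.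 $I$ is the $N\times N$ identity matrix. $A=(A_{ij})\in\mathbb{R}^{N\times N}$ is the tridiagonal matrix with $A_{jj}=\frac{2k_\alpha}{h}$ for $1\le j\le N$, $A_{j+1,j}=-\frac{k_\alpha}{h}$ for $1\le j\le N-1$, $A_{j-1,j}=-\frac{k_\alpha}{h}$ for $2\le j\le N$, all other entries $0$. $B=(B_{ij})\in\mathbb{R}^{N\times N}$ is the tridiagonal matrix with $B_{jj}=-\frac12f^m_{j-\frac12}+\frac12f^m_{j+\frac12}-f^l_{j-\frac12}+f^u_{j+\frac12}$ for $1\le j\le N$, $B_{j+1,j}=-\frac12f^m_{j+\frac12}-f^u_{j+\frac12}$ for $1\le j\le N-1$, $B_{j-1,j}=\frac12f^m_{j-\frac12}+f^l_{j-\frac12}$ for $2\le j\le N$, all other entries $0$. *)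

theory Defs
  imports
    "HOL-Analysis.Lipschitz"
    "HOL-Analysis.Gamma_Function"
    "Jordan_Normal_Form.Matrix"
begin

unbundle no vec_syntax

definition a_coeff :: "real \<Rightarrow> nat \<Rightarrow> real" where
  "a_coeff \<alpha> k = (real k + 1) powr (1 - \<alpha>) - real k powr (1 - \<alpha>)"

text \<open>\<open>x_half a h i\<close> is the midpoint $x_{i+1/2}$ of the cell $[a + ih, a + (i+1)h]$.\<close>

definition x_half :: "real \<Rightarrow> real \<Rightarrow> nat \<Rightarrow> real" where
  "x_half a h i = a + (real i + 1 / 2) * h"

definition f_u :: "real \<Rightarrow> real \<Rightarrow> (real \<Rightarrow> real) \<Rightarrow> real \<Rightarrow> real" where
  "f_u \<kappa> h f x = max (f x - 2 * \<kappa> / h) 0"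

definition f_l :: "real \<Rightarrow> real \<Rightarrow> (real \<Rightarrow> real) \<Rightarrow> real \<Rightarrow> real" where
  "f_l \<kappa> h f x = min (f x + 2 * \<kappa> / h) 0"

definition f_m :: "real \<Rightarrow> real \<Rightarrow> (real \<Rightarrow> real) \<Rightarrow> real \<Rightarrow> real" where
  "f_m \<kappa> h f x = f x - f_u \<kappa> h f x - f_l \<kappa> h f x"

text \<open>The entry functions below use the customary row and column numbers \<open>1, \<dots>, N\<close>;
  in them, the half-integer index $j - \frac12$ is $(j - 1) + \frac12$, i.e. the midpoint
  \<open>x_half a h (j - 1)\<close>. The matrices themselves are indexed from \<open>0\<close>, hence the shift by \<open>Suc\<close>.\<close>

definition A_entry :: "real \<Rightarrow> real \<Rightarrow> nat \<Rightarrow> nat \<Rightarrow> real" where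
  "A_entry \<kappa> h i j =
     (if i = j then 2 * \<kappa> / h
      else if i = j + 1 then - \<kappa> / h
      else if i + 1 = j then - \<kappa> / h
      else 0)"

definition B_entry :: "real \<Rightarrow> real \<Rightarrow> real \<Rightarrow> (real \<Rightarrow> real) \<Rightarrow> nat \<Rightarrow> nat \<Rightarrow> real" where
  "B_entry \<kappa> a h f i j =
     (let xm = x_half a h (j - 1); xp = x_half a h j in
      if i = j then
        - (1 / 2) * f_m \<kappa> h f xm + (1 / 2) * f_m \<kappa> h f xp - f_l \<kappa> h f xm + f_u \<kappa> h f xp
      else if i = j + 1 then - (1 / 2) * f_m \<kappa> h f xp - f_u \<kappa> h f xp
      else if i + 1 = j then (1 / 2) * f_m \<kappa> h f xm + f_l \<kappa> h f xm
      else 0)"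

definition A_mat :: "nat \<Rightarrow> real \<Rightarrow> real \<Rightarrow> real mat" where
  "A_mat N \<kappa> h = mat N N (\<lambda>(i, j). A_entry \<kappa> h (Suc i) (Suc j))"

definition B_mat :: "nat \<Rightarrow> real \<Rightarrow> real \<Rightarrow> real \<Rightarrow> (real \<Rightarrow> real) \<Rightarrow> real mat" where
  "B_mat N \<kappa> a h f = mat N N (\<lambda>(i, j). B_entry \<kappa> a h f (Suc i) (Suc j))"

end

theory Submission
  imports Defs
begin

text \<open>Every column of the iteration matrix has nonpositive off-diagonal entries and a positive
  sum, so the matrix is inverse-positive. The reason is that \<open>A + B\<close> is a discrete divergence:
  its interior columns sum to zero, and its first and last column, each lacking a nonpositive
  entry, have nonnegative sum; adding a positive multiple of the identity makes all column sums
  positive. The coefficients \<open>a\<^sub>k\<close> decrease because the power function with exponent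
  \<open>1 - \<alpha>\<close> is concave, so the right-hand side stays nonnegative and induction on the time level
  applies.\<close>

text \<open>In the sum of the rows in \<open>S\<close>, where \<open>v\<close> is negative, the
  factor of \<open>v j\<close> is the part of column \<open>j\<close> lying in \<open>S\<close>. For
  \<open>j\<close> in \<open>S\<close> it is positive, because only nonpositive off-diagonal entries
  were dropped; for other \<open>j\<close> it consists of off-diagonal entries and is nonpositive.
  So no term is positive and the one at \<open>k\<close> is negative.\<close>

lemma inverse_positive_col_dominant:
  fixes M :: "'i \<Rightarrow> 'i \<Rightarrow> real" and v :: "'i \<Rightarrow> real"
  assumes fin: "finite J"
    and off: "\<And>i j. i \<in> J \<Longrightarrow> j \<in> J \<Longrightarrow> i \<noteq> j \<Longrightarrow> M i j \<le> 0"
    and col: "\<And>j. j \<in> J \<Longrightarrow> (\<Sum>i\<in>J. M i j) > 0"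
    and nonneg: "\<And>i. i \<in> J \<Longrightarrow> (\<Sum>j\<in>J. M i j * v j) \<ge> 0"
    and "k \<in> J"
  shows "v k \<ge> 0"
proof (rule ccontr)
  assume neg: "\<not> v k \<ge> 0"
  \<comment> \<open>Adding up the rows in which \<open>v\<close> is negative gives a negative number.\<close>
  define S where "S = {i \<in> J. v i < 0}"
  have S: "S \<subseteq> J" "finite S" and kS: "k \<in> S"
    using fin neg \<open>k \<in> J\<close> by (auto simp: S_def)
  have colS: "(\<Sum>i\<in>S. M i j) > 0" if "j \<in> S" for j
  proof -
    have "(\<Sum>i\<in>J. M i j) = (\<Sum>i\<in>J - S. M i j) + (\<Sum>i\<in>S. M i j)"
      by (rule sum.subset_diff[OF S(1) fin])
    moreover have "(\<Sum>i\<in>J - S. M i j) \<le> 0"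
      using that S by (intro sum_nonpos off) auto
    moreover have "(\<Sum>i\<in>J. M i j) > 0"
      using that S by (intro col) auto
    ultimately show ?thesis by linarith
  qed
  have "0 \<le> (\<Sum>i\<in>S. \<Sum>j\<in>J. M i j * v j)"
    by (rule sum_nonneg) (use nonneg S in auto)
  also have "\<dots> = (\<Sum>j\<in>J. (\<Sum>i\<in>S. M i j) * v j)"
    by (subst sum.swap) (simp add: sum_distrib_right)
  also have "\<dots> < (\<Sum>j\<in>J. 0)"
  proof (rule sum_strict_mono_ex1[OF fin])
    show "\<forall>j\<in>J. (\<Sum>i\<in>S. M i j) * v j \<le> 0"
    proof
      fix j assume j: "j \<in> J"
      show "(\<Sum>i\<in>S. M i j) * v j \<le> 0"
      proof (cases "j \<in> S")
        case True
        then show ?thesis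
          using colS[OF True] by (intro mult_nonneg_nonpos) (auto simp: S_def)
      next
        case False
        then have "(\<Sum>i\<in>S. M i j) \<le> 0"
          using j S by (intro sum_nonpos off) auto
        with False j show ?thesis
          by (intro mult_nonpos_nonneg) (auto simp: S_def)
      qed
    qed
    show "\<exists>j\<in>J. (\<Sum>i\<in>S. M i j) * v j < 0"
      using colS[OF kS] kS S by (intro bexI[of _ k] mult_pos_neg) (auto simp: S_def)
  qed
  finally show False by simp
qed

lemma sum_tridiagonal_column:
  fixes d l u :: "'a::comm_monoid_add"
  assumes "j < N"
  shows "(\<Sum>i<N. if i = j then d else if i = Suc j then l else if Suc i = j then u else 0) =
    d + (if Suc j < N then l else 0) + (if 0 < j then u else 0)"
proof -
  \<comment> \<open>The guard \<open>0 < j\<close> is essential: for \<open>j = 0\<close> truncated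
    subtraction makes \<open>j - 1\<close> the diagonal row, which must not receive
    \<open>u\<close>.\<close>
  have "(\<Sum>i<N. if i = j then d else if i = Suc j then l else if Suc i = j then u else 0) =
    (\<Sum>i<N. (if i = j then d else 0) + (if i = Suc j then l else 0) +
      (if i = j - 1 then (if 0 < j then u else 0) else 0))"
    by (intro sum.cong) auto
  also have "\<dots> = d + (if Suc j < N then l else 0) + (if 0 < j then u else 0)"
    using assms by (auto simp: sum.distrib)
  finally show ?thesis .
qed

lemma a_coeff_nonneg:
  assumes "\<alpha> \<le> 1"
  shows "0 \<le> a_coeff \<alpha> k"
  using assms by (auto simp: a_coeff_def intro!: powr_mono2)

text \<open>With \<open>p = 1 - \<alpha>\<close> this is midpoint concavity of
  \<open>x powr p\<close> on the points \<open>k\<close>, \<open>k + 1\<close>,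
  \<open>k + 2\<close>.\<close>

lemma a_coeff_Suc_le:
  assumes "0 \<le> \<alpha>" "\<alpha> \<le> 1"
  shows "a_coeff \<alpha> (Suc k) \<le> a_coeff \<alpha> k"
proof -
  define p where "p = 1 - \<alpha>"
  define m where "m = real k + 1"
  have m: "m > 0" by (simp add: m_def)
  \<comment> \<open>Weighted AM-GM. Divided by \<open>m powr \<alpha>\<close>, it bounds
    \<open>x powr p\<close> by its tangent at \<open>m\<close>; since \<open>m\<close> is the mean
    of \<open>k\<close> and \<open>k + 2\<close>, the linear terms add up to
    \<open>2 * m\<close>.\<close>
  have young: "x powr p * m powr \<alpha> \<le> p * x + \<alpha> * m" if "x \<ge> 0" for x
  proof (cases "x = 0")
    case False
    then show ?thesis
      using that assms m Youngs_inequality_0[of p \<alpha> x m] by (simp add: p_def)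
  qed (use assms m in simp)
  have "(real k powr p + (real k + 2) powr p) * m powr \<alpha> \<le> 2 * m"
    using young[of "real k"] young[of "real k + 2"] by (simp add: p_def m_def algebra_simps)
  also have "2 * m = (2 * m powr p) * m powr \<alpha>"
    using m by (simp add: p_def flip: powr_add)
  finally have "real k powr p + (real k + 2) powr p \<le> 2 * m powr p"
    using m by (simp add: mult_le_cancel_right)
  then show ?thesis
    by (simp add: a_coeff_def p_def m_def algebra_simps)
qed

text \<open>\<open>f_m\<close> is \<open>f\<close> clamped to the interval from
  \<open>- 2 * \<kappa> / h\<close> to \<open>2 * \<kappa> / h\<close>, so half of it is at most
  \<open>\<kappa> / h\<close> in absolute value, while \<open>f_u\<close> is nonnegative and
  \<open>f_l\<close> nonpositive. The two expressions are the negated sub- and superdiagonal entries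
  of \<open>A + B\<close>.\<close>

lemma
  fixes f :: "real \<Rightarrow> real"
  assumes "\<kappa> > 0" "h > 0"
  shows flux_weight_u: "0 \<le> \<kappa> / h + (1 / 2) * f_m \<kappa> h f x + f_u \<kappa> h f x"
    and flux_weight_l: "0 \<le> \<kappa> / h - (1 / 2) * f_m \<kappa> h f x - f_l \<kappa> h f x"
proof -
  define q where "q = \<kappa> / h"
  have "q > 0" using assms by (simp add: q_def)
  moreover have "2 * \<kappa> / h = 2 * q" by (simp add: q_def)
  ultimately show "0 \<le> \<kappa> / h + (1 / 2) * f_m \<kappa> h f x + f_u \<kappa> h f x"
    and "0 \<le> \<kappa> / h - (1 / 2) * f_m \<kappa> h f x - f_l \<kappa> h f x"
    unfolding f_m_def f_u_def f_l_def q_def[symmetric] by (auto simp: max_def min_def)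
qed

lemma AB_entry_off_diagonal:
  assumes "\<kappa> > 0" "h > 0" "i \<noteq> j"
  shows "A_entry \<kappa> h i j + B_entry \<kappa> a h f i j \<le> 0"
  using assms(3) flux_weight_u[OF assms(1,2), of f "x_half a h j"]
    flux_weight_l[OF assms(1,2), of f "x_half a h (j - 1)"]
  by (auto simp: A_entry_def B_entry_def Let_def)

lemma AB_entry_column_sum:
  assumes "\<kappa> > 0" "h > 0" "j < N"
  shows "0 \<le> (\<Sum>i<N. A_entry \<kappa> h (Suc i) (Suc j) + B_entry \<kappa> a h f (Suc i) (Suc j))"
proof -
  let ?xm = "x_half a h j" and ?xp = "x_half a h (Suc j)"
  \<comment> \<open>\<open>l\<close> and \<open>u\<close> are the entries below and above the
    diagonal. The diagonal entry takes its fluxes at the same two midpoints and equals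
    \<open>- l - u\<close>. With columns counted from \<open>0\<close>, the left midpoint of column
    \<open>j\<close> is \<open>x_half a h j\<close>.\<close>
  define l where "l = - (\<kappa> / h + (1 / 2) * f_m \<kappa> h f ?xp + f_u \<kappa> h f ?xp)"
  define u where "u = - (\<kappa> / h - (1 / 2) * f_m \<kappa> h f ?xm - f_l \<kappa> h f ?xm)"
  have "(\<Sum>i<N. A_entry \<kappa> h (Suc i) (Suc j) + B_entry \<kappa> a h f (Suc i) (Suc j)) =
    (\<Sum>i<N. if i = j then - l - u else if i = Suc j then l else if Suc i = j then u else 0)"
    by (intro sum.cong) (auto simp: A_entry_def B_entry_def Let_def l_def u_def)
  also have "\<dots> = - l - u + (if Suc j < N then l else 0) + (if 0 < j then u else 0)"
    by (rule sum_tridiagonal_column[OF assms(3)])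
  also have "\<dots> \<ge> 0"
    using flux_weight_u[OF assms(1,2), of f ?xp] flux_weight_l[OF assms(1,2), of f ?xm]
    unfolding l_def u_def by auto
  finally show ?thesis .
qed

lemma zero_vec_le_iff:
  assumes "v \<in> carrier_vec n"
  shows "0\<^sub>v n \<le> v \<longleftrightarrow> (\<forall>i<n. 0 \<le> v $ i)"
  using assms by (auto simp: less_eq_vec_def)

lemma iteration_matrix_inverse_positive:
  fixes v :: "real vec"
  assumes "\<kappa> > 0" "h > 0" "c > 0" and v: "v \<in> carrier_vec N"
    and nonneg: "0\<^sub>v N \<le> (c \<cdot>\<^sub>m 1\<^sub>m N + A_mat N \<kappa> h + B_mat N \<kappa> a h f) *\<^sub>v v"
  shows "0\<^sub>v N \<le> v"
proof -
  define E where "E i j = A_entry \<kappa> h (Suc i) (Suc j) + B_entry \<kappa> a h f (Suc i) (Suc j)" for i j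
  \<comment> \<open>The positive shift \<open>c\<close> makes the column sums strictly positive:
    those of \<open>E\<close> may vanish.\<close>
  define M where "M i j = (if i = j then c else 0) + E i j" for i j :: nat
  have "v $ k \<ge> 0" if "k < N" for k
  proof (rule inverse_positive_col_dominant[where J = "{..<N}" and M = M and v = "($) v"])
    show "M i j \<le> 0" if "i \<noteq> j" for i j
      using that AB_entry_off_diagonal[OF assms(1,2), of "Suc i" "Suc j" a f]
      by (simp add: M_def E_def)
    show "(\<Sum>i<N. M i j) > 0" if "j \<in> {..<N}" for j
    proof -
      have "(\<Sum>i<N. M i j) = c + (\<Sum>i<N. E i j)"
        using that by (simp add: M_def sum.distrib)
      then show ?thesis
        using that \<open>c > 0\<close> AB_entry_column_sum[OF assms(1,2), of j N a f] by (simp add: E_def)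
    qed
    show "(\<Sum>j<N. M i j * v $ j) \<ge> 0" if "i \<in> {..<N}" for i
    proof -
      have "(\<Sum>j<N. M i j * v $ j) =
        ((c \<cdot>\<^sub>m 1\<^sub>m N + A_mat N \<kappa> h + B_mat N \<kappa> a h f) *\<^sub>v v) $ i"
        using that v
        by (auto simp: M_def E_def scalar_prod_def A_mat_def B_mat_def atLeast0LessThan
            intro!: sum.cong)
      then show ?thesis
        using that nonneg by (auto simp: less_eq_vec_def A_mat_def B_mat_def)
    qed
  qed (use that in auto)
  then show ?thesis
    using zero_vec_le_iff[OF v] by simp
qed

theorem lemma3p1:
  fixes a b T \<alpha> \<kappa> C h \<tau> :: real
    and f :: "real \<Rightarrow> real"
    and N L :: nat
    and e r :: "nat \<Rightarrow> real vec"
  assumes "a < b" and "T > 0" and "0 < \<alpha>" and "\<alpha> < 1" and "\<kappa> > 0"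
    and "C-lipschitz_on {a..b} f"
    and "N \<ge> 1" and "L \<ge> 1"
    and "h = (b - a) / (real N + 1)" and "\<tau> = T / real L"
    and "\<And>n. n \<le> L \<Longrightarrow> e n \<in> carrier_vec N"
    and "\<And>n. 1 \<le> n \<Longrightarrow> n \<le> L \<Longrightarrow> r n \<in> carrier_vec N"
    and "\<And>n. 1 \<le> n \<Longrightarrow> n \<le> L \<Longrightarrow>
      ((h * \<tau> powr (- \<alpha>) / Gamma (2 - \<alpha>)) \<cdot>\<^sub>m 1\<^sub>m N + A_mat N \<kappa> h + B_mat N \<kappa> a h f) *\<^sub>v e n =
      (h * \<tau> powr (- \<alpha>) / Gamma (2 - \<alpha>)) \<cdot>\<^sub>v
        (finsum_vec TYPE(real) N
           (\<lambda>k. (a_coeff \<alpha> (n - k - 1) - a_coeff \<alpha> (n - k)) \<cdot>\<^sub>v e k) {1..n - 1}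
         + a_coeff \<alpha> (n - 1) \<cdot>\<^sub>v e 0)
      + h \<cdot>\<^sub>v r n"
    and "0\<^sub>v N \<le> e 0"
    and "\<And>n. 1 \<le> n \<Longrightarrow> n \<le> L \<Longrightarrow> 0\<^sub>v N \<le> r n"
  shows "\<forall>n\<in>{1..L}. 0\<^sub>v N \<le> e n"
proof -
  have h: "h > 0" using assms(1,9) by simp
  define c where "c = h * \<tau> powr (- \<alpha>) / Gamma (2 - \<alpha>)"
  have c: "c > 0"
    unfolding c_def using assms(2,4,8,10) h by (intro divide_pos_pos mult_pos_pos Gamma_real_pos) auto
  have "0\<^sub>v N \<le> e n" if "n \<le> L" for n
    using that
  \<comment> \<open>Strong induction, since the memory term involves all earlier levels. Level
    \<open>0\<close> is included because \<open>e 0\<close> occurs on the right-hand side; for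
    \<open>n = 1\<close> it is the only earlier level, the range \<open>{1..n - 1}\<close> being
    empty.\<close>
  proof (induction n rule: less_induct)
    case (less n)
    show ?case
    proof (cases "n = 0")
      case True
      then show ?thesis using assms(14) by simp
    next
      case False
      then have n: "1 \<le> n" "n \<le> L" using less.prems by auto
      let ?w = "\<lambda>k. (a_coeff \<alpha> (n - k - 1) - a_coeff \<alpha> (n - k)) \<cdot>\<^sub>v e k"
      let ?R = "c \<cdot>\<^sub>v (finsum_vec TYPE(real) N ?w {1..n - 1} + a_coeff \<alpha> (n - 1) \<cdot>\<^sub>v e 0) + h \<cdot>\<^sub>v r n"
      have w: "?w \<in> {1..n - 1} \<rightarrow> carrier_vec N"
        using n assms(11) by auto
      have e0: "e 0 \<in> carrier_vec N" and r: "r n \<in> carrier_vec N"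
        using assms(11)[of 0] assms(12)[OF n] by auto
      have e_nonneg: "0 \<le> e k $ i" if "k < n" "i < N" for k i
        using less.IH[of k] that n zero_vec_le_iff[OF assms(11)[of k]] by simp
      have r_nonneg: "0 \<le> r n $ i" if "i < N" for i
        using assms(15)[OF n] that zero_vec_le_iff[OF r] by simp
      have R: "?R \<in> carrier_vec N"
        using finsum_vec_closed[OF w] e0 r by simp
      have "0 \<le> ?R $ i" if i: "i < N" for i
      proof -
        have "0 \<le> (\<Sum>k\<in>{1..n - 1}. ?w k $ i)"
        proof (rule sum_nonneg)
          fix k assume k: "k \<in> {1..n - 1}"
          \<comment> \<open>Here \<open>k < n\<close>, so \<open>n - k - 1\<close> is not truncated
            and the two coefficients are consecutive.\<close>
          then have "n - k = Suc (n - k - 1)" by auto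
          then have "a_coeff \<alpha> (n - k) \<le> a_coeff \<alpha> (n - k - 1)"
            using a_coeff_Suc_le[of \<alpha> "n - k - 1"] assms(3,4) by simp
          moreover have "0 \<le> e k $ i" and "e k \<in> carrier_vec N"
            using k n i e_nonneg assms(11) by auto
          ultimately show "0 \<le> ?w k $ i" using i by simp
        qed
        then have sum: "0 \<le> finsum_vec TYPE(real) N ?w {1..n - 1} $ i"
          using index_finsum_vec[OF _ i w] by simp
        have init: "0 \<le> a_coeff \<alpha> (n - 1) * e 0 $ i"
          using a_coeff_nonneg[of \<alpha> "n - 1"] e_nonneg[of 0 i] assms(4) n i by simp
        have "?R $ i = c * (finsum_vec TYPE(real) N ?w {1..n - 1} $ i
            + a_coeff \<alpha> (n - 1) * e 0 $ i) + h * r n $ i"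
          using i e0 r finsum_vec_closed[OF w] by simp
        then show ?thesis
          using c h sum init r_nonneg[OF i] by simp
      qed
      then have "0\<^sub>v N \<le> ?R"
        unfolding zero_vec_le_iff[OF R] by blast
      \<comment> \<open>By the recursion \<open>?R\<close> is the iteration matrix applied to
        \<open>e n\<close>, so its sign passes to \<open>e n\<close>.\<close>
      then show ?thesis
        using iteration_matrix_inverse_positive[OF assms(5) h c, of "e n" N a f]
          assms(11,13)[of n] n by (simp add: c_def)
    qed
  qed
  then show ?thesis by auto
qed

end
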